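(* Let $k\ge 1$ and let $G=(V,E)$ be a finite symmetric complete $k$-partite graph, i.e. suppose that $V$ can be decomposed into disjoint subsets $V_1,\dots,V_k$ such that $|V_1|=\dots=|V_k|$ and $E=\{uv:\ \exists\, i\neq j:\ u\in V_i,\ v\in V_j\}$. Then $G$ satisfies the bunkbed property (B3), i.e. for all $p\in[0,1]$ and all $v,w\in V$, $$\mathbb{P}_{p}(v_-\leftrightarrow w_-)\ \ge\ \mathbb{P}_{p}(v_-\leftrightarrow w_+).$$
   Context: All graphs are simple and undirected; $uv$ denotes the edge $\{u,v\}$. For a finite graph $G=(V,E)$ the bunkbed graph $G^\pm=(V^\pm,E^\pm)$ has vertex set $V^\pm:=V\times\{+,-\}$, where we write $v_+:=(v,+)$ and $v_-:=(v,-)$, and edge set $E^\pm:=\{u_+v_+,\,u_-v_-: uv\in E\}\cup\{u_+u_-: u\in V\}$. For $p\in[0,1]$, $\mathbb{P}_p$ denotes independent bond percolation on $G^\pm$ with constant edge probability $p$ on all edges (horizontal and vertical): $(\mathcal{Z}_e)_{e\in E^\pm}$ are independent $\{0,1\}$-valued random variables with $\mathbb{P}_p(\mathcal{Z}_e=1)=p$ for all $e\in E^\pm$; the edge $e$ is open if $\mathcal{Z}_e=1$ and closed if $\mathcal{Z}_e=0$. For $x,y\in V^\pm$, $x\leftrightarrow y$ is the event that $x$ and $y$ are joined by a (possibly trivial) path of finitely many open edges of $G^\pm$. *)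

theory Defs
  imports "HOL-Probability.Probability"
begin

text \<open>A simple undirected graph is a vertex set \<open>V\<close> together with a set \<open>E\<close> of two-element
  subsets of \<open>V\<close>.\<close>

datatype layer = Plus | Minus

definition bunkbed_verts :: "'a set \<Rightarrow> ('a \<times> layer) set" where
  "bunkbed_verts V = V \<times> {Plus, Minus}"

definition bunkbed_edges :: "'a set \<Rightarrow> 'a set set \<Rightarrow> ('a \<times> layer) set set" where
  "bunkbed_edges V E =
     {{(u, Plus), (v, Plus)} | u v. {u, v} \<in> E} \<union>
     {{(u, Minus), (v, Minus)} | u v. {u, v} \<in> E} \<union>
     {{(u, Plus), (u, Minus)} | u. u \<in> V}"

text \<open>The joint law of the edge states: \<open>Z e\<close> means that the edge \<open>e\<close> is open. The states are
  independent Bernoulli variables; outside \<open>bunkbed_edges V E\<close> the state is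
  \<open>False\<close> by convention of \<open>Pi_pmf\<close>, which is never used below.\<close>

definition percolation ::
    "'a set \<Rightarrow> 'a set set \<Rightarrow> real \<Rightarrow> (('a \<times> layer) set \<Rightarrow> bool) pmf" where
  "percolation V E p = Pi_pmf (bunkbed_edges V E) False (\<lambda>_. bernoulli_pmf p)"

definition open_path ::
    "'a set \<Rightarrow> 'a set set \<Rightarrow> (('a \<times> layer) set \<Rightarrow> bool) \<Rightarrow> ('a \<times> layer) list \<Rightarrow> bool" where
  "open_path V E Z xs \<longleftrightarrow>
     xs \<noteq> [] \<and> set xs \<subseteq> bunkbed_verts V \<and> distinct xs \<and>
     successively (\<lambda>x y. {x, y} \<in> bunkbed_edges V E \<and> Z {x, y}) xs"

definition open_connected ::
    "'a set \<Rightarrow> 'a set set \<Rightarrow> (('a \<times> layer) set \<Rightarrow> bool) \<Rightarrow> 'a \<times> layer \<Rightarrow> 'a \<times> layer \<Rightarrow> bool" where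
  "open_connected V E Z x y \<longleftrightarrow> (\<exists>xs. open_path V E Z xs \<and> hd xs = x \<and> last xs = y)"

definition conn_prob ::
    "'a set \<Rightarrow> 'a set set \<Rightarrow> real \<Rightarrow> 'a \<times> layer \<Rightarrow> 'a \<times> layer \<Rightarrow> real" where
  "conn_prob V E p x y = measure_pmf.prob (percolation V E p) {Z. open_connected V E Z x y}"

definition bunkbed_property :: "'a set \<Rightarrow> 'a set set \<Rightarrow> bool" where
  "bunkbed_property V E \<longleftrightarrow>
     (\<forall>p\<in>{0..1}. \<forall>v\<in>V. \<forall>w\<in>V.
        conn_prob V E p (v, Minus) (w, Minus) \<ge> conn_prob V E p (v, Minus) (w, Plus))"

definition symmetric_complete_partite :: "nat \<Rightarrow> 'a set \<Rightarrow> 'a set set \<Rightarrow> bool" where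
  "symmetric_complete_partite k V E \<longleftrightarrow>
     (\<exists>W :: nat \<Rightarrow> 'a set.
        V = (\<Union>i\<in>{1..k}. W i) \<and>
        disjoint_family_on W {1..k} \<and>
        (\<forall>i\<in>{1..k}. \<forall>j\<in>{1..k}. card (W i) = card (W j)) \<and>
        E = {{u, v} | u v. \<exists>i\<in>{1..k}. \<exists>j\<in>{1..k}. i \<noteq> j \<and> u \<in> W i \<and> v \<in> W j})"

end

theory Submission
  imports Defs "HOL-Library.Transitive_Closure_Table"
begin

text \<open>Write \<open>F v w\<close> for the number of connections between copies of \<open>v\<close> and
  \<open>w\<close> within a layer minus the number of those between the layers. Exchanging the layers shows that
  the claim is equivalent to \<open>F v w\<close> having nonnegative expectation. If the two copies of
  \<open>v\<close> are connected, then \<open>F v w = 0\<close>; in particular the vertical edges at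
  \<open>v\<close> and \<open>w\<close> may be assumed closed. The case \<open>v = w\<close> is trivial. In
  both cases below one conditions on all edges away from \<open>v\<close> (and \<open>w\<close>) and studies how
  the horizontal stars attach to the resulting clusters, which they do independently for different clusters.

  Adjacent vertices. For every \<open>v\<close>, the sum of \<open>F v w\<close> over the neighbours
  \<open>w\<close> of \<open>v\<close> has nonnegative expectation (\<open>nbrs_sum_signed_conn_nonneg\<close>).
  Unless some cluster is attached to both copies of \<open>v\<close>, this sum is the sum over the clusters
  attached to the lower copy of \<open>v\<close>, minus that over the clusters attached to the upper copy, of
  the difference \<open>d\<close> between the numbers of lower and upper copies of neighbours of
  \<open>v\<close> in the cluster. A cluster with \<open>d \<ge> 0\<close> is at least as likely to be
  attached to the lower copy of \<open>v\<close> as to the upper copy, and conversely for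
  \<open>d \<le> 0\<close>. In a symmetric complete multipartite graph the automorphisms that fix
  \<open>v\<close> act transitively on its neighbours, so all summands have the same expectation.

  Distinct vertices of the same class. They are twins, that is, they have the same neighbours, so that given the
  other edges their stars are independent with the same law (\<open>twins_signed_conn_nonneg\<close>). If no
  cluster is attached to both copies of one vertex, each cluster \<open>i\<close> hit by both \<open>v\<close>
  and \<open>w\<close> carries two signs, the layers of the copies of \<open>v\<close> and \<open>w\<close> that
  it links. If there is no such cluster, then \<open>F v w = 0\<close>. Given a nonempty set of these
  clusters, the two sign vectors are independent with the same product law \<open>P\<close>. The value of
  \<open>F v w\<close> is 2 if the vectors agree and are not constant, -2 if they are opposite and not
  constant, 1 or -1 if both are constant and equal or opposite, and 0 otherwise. Hence its expectation is a
  nonnegative combination of the squares \<open>(P x - P (- x))\<^sup>2\<close>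
  (\<open>prod_squares_ge\<close>).\<close>

section \<open>Expectations over random subsets of a finite set\<close>

text \<open>The expectation of \<open>h\<close> over a random subset of the finite set \<open>A\<close> that
  contains each element independently with probability \<open>p\<close>. An open/closed configuration is
  identified with its set of open edges, so that independence of disjoint sets of edges becomes Fubini for
  finite sums (\<open>bexp_union\<close>).\<close>
definition bexp :: "real \<Rightarrow> 'b set \<Rightarrow> ('b set \<Rightarrow> real) \<Rightarrow> real" where
  "bexp p A h = (\<Sum>S\<in>Pow A. p ^ card S * (1 - p) ^ card (A - S) * h S)"

lemma bexp_cong:
  assumes "\<And>S. S \<subseteq> A \<Longrightarrow> h S = h' S"
  shows "bexp p A h = bexp p A h'"
  unfolding bexp_def using assms by (intro sum.cong) auto

lemma bexp_nonneg:
  assumes "p \<in> {0..1}" "\<And>S. S \<subseteq> A \<Longrightarrow> 0 \<le> h S"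
  shows "0 \<le> bexp p A h"
  unfolding bexp_def using assms by (intro sum_nonneg mult_nonneg_nonneg) auto

lemma bexp_add: "bexp p A (\<lambda>S. h S + h' S) = bexp p A h + bexp p A h'"
  by (simp add: bexp_def algebra_simps sum.distrib)

lemma bexp_diff: "bexp p A (\<lambda>S. h S - h' S) = bexp p A h - bexp p A h'"
  by (simp add: bexp_def algebra_simps sum_subtractf)

lemma bexp_cmult: "bexp p A (\<lambda>S. c * h S) = c * bexp p A h"
  by (simp add: bexp_def algebra_simps sum_distrib_left)

lemma bexp_multc: "bexp p A (\<lambda>S. h S * c) = bexp p A h * c"
  by (simp add: bexp_def algebra_simps sum_distrib_left)

lemma bexp_sum: "bexp p A (\<lambda>S. \<Sum>i\<in>I. h i S) = (\<Sum>i\<in>I. bexp p A (h i))"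
  unfolding bexp_def by (subst sum.swap) (simp add: sum_distrib_left)

lemma bexp_empty [simp]: "bexp p {} h = h {}"
  by (simp add: bexp_def)

lemma bexp_union:
  assumes "finite A" "finite B" "A \<inter> B = {}"
  shows "bexp p (A \<union> B) h = bexp p A (\<lambda>S. bexp p B (\<lambda>T. h (S \<union> T)))"
proof -
  have "bexp p (A \<union> B) h =
      (\<Sum>(S, T)\<in>Pow A \<times> Pow B. p ^ card (S \<union> T) * (1 - p) ^ card (A \<union> B - (S \<union> T)) * h (S \<union> T))"
    unfolding bexp_def
    by (rule sum.reindex_bij_witness[where i = "\<lambda>(S, T). S \<union> T" and j = "\<lambda>S. (S \<inter> A, S \<inter> B)"])
      (use assms in \<open>auto simp: Int_Un_distrib[symmetric] Int_absorb2\<close>)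
  also have "\<dots> = (\<Sum>(S, T)\<in>Pow A \<times> Pow B.
      p ^ card S * (1 - p) ^ card (A - S) * (p ^ card T * (1 - p) ^ card (B - T) * h (S \<union> T)))"
  proof (intro sum.cong refl, clarify)
    fix S T assume *: "S \<subseteq> A" "T \<subseteq> B"
    have fin: "finite S" "finite T" using * assms by (auto intro: finite_subset)
    have "card (S \<union> T) = card S + card T"
      using * assms fin by (intro card_Un_disjoint) auto
    moreover have "A \<union> B - (S \<union> T) = (A - S) \<union> (B - T)" using * assms by auto
    moreover have "card ((A - S) \<union> (B - T)) = card (A - S) + card (B - T)"
      using assms by (intro card_Un_disjoint) auto
    ultimately show "p ^ card (S \<union> T) * (1 - p) ^ card (A \<union> B - (S \<union> T)) * h (S \<union> T) =
      p ^ card S * (1 - p) ^ card (A - S) * (p ^ card T * (1 - p) ^ card (B - T) * h (S \<union> T))"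
      by (simp add: power_add)
  qed
  also have "\<dots> = bexp p A (\<lambda>S. bexp p B (\<lambda>T. h (S \<union> T)))"
    by (simp add: bexp_def sum.cartesian_product sum_distrib_left)
  finally show ?thesis .
qed

lemma bexp_const [simp]:
  assumes "finite A"
  shows "bexp p A (\<lambda>_. c) = c"
  using assms
proof (induction A)
  case (insert x A)
  have "bexp p ({x} \<union> A) (\<lambda>_. c) = bexp p {x} (\<lambda>_. c)"
    using insert by (subst bexp_union) auto
  also have "\<dots> = c" by (simp add: bexp_def Pow_insert algebra_simps)
  finally show ?case by simp
qed simp

lemma bexp_image:
  assumes "inj_on f A"
  shows "bexp p (f ` A) h = bexp p A (\<lambda>S. h (f ` S))"
  unfolding bexp_def
proof (rule sum.reindex_cong[of "image f"])
  show "inj_on ((`) f) (Pow A)" using assms by (rule inj_on_image_Pow)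
  show "Pow (f ` A) = (`) f ` Pow A" by (simp add: image_Pow_surj)
  fix S assume "S \<in> Pow A"
  then have "S \<subseteq> A" by simp
  then have "card (f ` S) = card S" "card (f ` A - f ` S) = card (A - S)"
    using assms by (auto simp: card_image inj_on_subset inj_on_image_set_diff[symmetric])
  then show "p ^ card (f ` S) * (1 - p) ^ card (f ` A - f ` S) * h (f ` S) =
         p ^ card S * (1 - p) ^ card (A - S) * h (f ` S)" by simp
qed

lemma bexp_avoid:
  assumes "finite A" "B \<subseteq> A"
  shows "bexp p A (\<lambda>S. of_bool (S \<inter> B = {})) = (1 - p) ^ card B"
proof -
  have "bexp p (B \<union> (A - B)) (\<lambda>S. of_bool (S \<inter> B = {})) =
      bexp p B (\<lambda>S. bexp p (A - B) (\<lambda>T. of_bool ((S \<union> T) \<inter> B = {})))"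
    using assms finite_subset by (intro bexp_union) auto
  also have "\<dots> = bexp p B (\<lambda>S. bexp p (A - B) (\<lambda>T. of_bool (S = {})))"
    by (intro bexp_cong) (auto intro!: arg_cong[where f = of_bool])
  also have "\<dots> = bexp p B (\<lambda>S. of_bool (S = {}))"
    using assms by simp
  also have "\<dots> = (\<Sum>S\<in>{{}}. p ^ card S * (1 - p) ^ card (B - S))"
    unfolding bexp_def using assms finite_subset
    by (intro sum.mono_neutral_cong_right) auto
  finally show ?thesis using assms by (simp add: Un_absorb1)
qed

text \<open>Functions of the restrictions of the random set to the fibres of \<open>cl\<close> are
  independent.\<close>
lemma bexp_blocks:
  assumes "finite M" "finite K"
  shows "bexp p {z\<in>M. cl z \<in> K} (\<lambda>X. \<Prod>c\<in>K. h c {z\<in>X. cl z = c}) =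
    (\<Prod>c\<in>K. bexp p {z\<in>M. cl z = c} (h c))"
  using assms(2)
proof (induction K)
  case (insert k K)
  let ?A = "{z\<in>M. cl z = k}" and ?B = "{z\<in>M. cl z \<in> K}"
  have "{z\<in>M. cl z \<in> insert k K} = ?A \<union> ?B" by auto
  then have "bexp p {z\<in>M. cl z \<in> insert k K} (\<lambda>X. \<Prod>c\<in>insert k K. h c {z\<in>X. cl z = c}) =
     bexp p ?A (\<lambda>S. bexp p ?B (\<lambda>T. \<Prod>c\<in>insert k K. h c {z\<in>S \<union> T. cl z = c}))"
    using assms insert by (simp only:) (intro bexp_union; auto)
  also have "\<dots> = bexp p ?A (\<lambda>S. bexp p ?B (\<lambda>T. h k S * (\<Prod>c\<in>K. h c {z\<in>T. cl z = c})))"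
  proof (intro bexp_cong)
    fix S T assume *: "S \<subseteq> ?A" "T \<subseteq> ?B"
    have "{z\<in>S \<union> T. cl z = k} = S" using * insert by auto
    moreover have "{z\<in>S \<union> T. cl z = c} = {z\<in>T. cl z = c}" if "c \<in> K" for c
      using * insert that by auto
    ultimately show "(\<Prod>c\<in>insert k K. h c {z\<in>S \<union> T. cl z = c}) =
        h k S * (\<Prod>c\<in>K. h c {z\<in>T. cl z = c})"
      using insert by simp
  qed
  also have "\<dots> = bexp p ?A (h k) * bexp p ?B (\<lambda>T. \<Prod>c\<in>K. h c {z\<in>T. cl z = c})"
    by (simp add: bexp_cmult bexp_multc)
  finally show ?case using insert by simp
qed simp

lemma bexp_clusters:
  assumes "finite M"
  shows "bexp p M (\<lambda>X. \<Prod>c\<in>cl ` M. h c {z\<in>X. cl z = c}) =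
    (\<Prod>c\<in>cl ` M. bexp p {z\<in>M. cl z = c} (h c))"
proof -
  have "{z\<in>M. cl z \<in> cl ` M} = M" by auto
  with bexp_blocks[of M "cl ` M" p cl h] assms show ?thesis by simp
qed

section \<open>A polynomial inequality\<close>

text \<open>If \<open>P\<close> is the product measure on sign vectors indexed by \<open>I\<close> with
  weights \<open>u i\<close> for \<open>+\<close> and \<open>s i\<close> for \<open>-\<close>, the left-hand
  side of the first inequality is the sum of \<open>P x * (P x - P (- x))\<close> over all
  \<open>x\<close>, which is half the sum of \<open>(P x - P (- x))\<^sup>2\<close>. The two constant
  vectors alone contribute the right-hand side. The second inequality only serves the induction; the case
  \<open>I = {}\<close> must be excluded there, because both products on its right are then 1.\<close>
lemma prod_squares_ge:
  fixes u s :: "'i \<Rightarrow> real"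
  assumes "finite I" "\<And>i. 0 \<le> u i" "\<And>i. 0 \<le> s i"
  shows "(\<Prod>i\<in>I. (u i)\<^sup>2 + (s i)\<^sup>2) - (\<Prod>i\<in>I. 2 * u i * s i) \<ge> (prod u I - prod s I)\<^sup>2
   \<and> (I = {} \<or> (\<Prod>i\<in>I. (u i)\<^sup>2 + (s i)\<^sup>2) \<ge> (prod u I)\<^sup>2 + (prod s I)\<^sup>2)"
  using assms(1)
proof (induction I)
  case (insert k I)
  define P R U S a b where
    "P = (\<Prod>i\<in>I. (u i)\<^sup>2 + (s i)\<^sup>2)" and "R = (\<Prod>i\<in>I. 2 * u i * s i)" and
    "U = prod u I" and "S = prod s I" and "a = u k" and "b = s k"
  have ab: "0 \<le> a" "0 \<le> b" using assms by (auto simp: a_def b_def)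
  have IH: "P - R \<ge> (U - S)\<^sup>2" "I = {} \<or> P \<ge> U\<^sup>2 + S\<^sup>2"
    using insert by (auto simp: P_def R_def U_def S_def)
  show ?case
  proof (cases "I = {}")
    case True
    then show ?thesis by (simp add: power2_eq_square algebra_simps)
  next
    case False
    then have P: "P \<ge> U\<^sup>2 + S\<^sup>2" using IH by simp
    have 1: "P * (a\<^sup>2 + b\<^sup>2) \<ge> (a * U)\<^sup>2 + (b * S)\<^sup>2"
    proof -
      have "(U\<^sup>2 + S\<^sup>2) * (a\<^sup>2 + b\<^sup>2) \<le> P * (a\<^sup>2 + b\<^sup>2)"
        using P by (intro mult_right_mono) auto
      moreover have "(U\<^sup>2 + S\<^sup>2) * (a\<^sup>2 + b\<^sup>2) = (a*U)\<^sup>2 + (b*S)\<^sup>2 + ((a*S)\<^sup>2 + (b*U)\<^sup>2)"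
        by (simp add: power2_eq_square algebra_simps)
      moreover have "0 \<le> (a*S)\<^sup>2 + (b*U)\<^sup>2" by simp
      ultimately show ?thesis by linarith
    qed
    have "(U\<^sup>2 + S\<^sup>2) * (a - b)\<^sup>2 \<le> P * (a - b)\<^sup>2"
      using P by (intro mult_right_mono) auto
    moreover have "(U - S)\<^sup>2 * (2 * a * b) \<le> (P - R) * (2 * a * b)"
      using IH ab by (intro mult_right_mono) auto
    moreover have "(U\<^sup>2 + S\<^sup>2) * (a - b)\<^sup>2 + (U - S)\<^sup>2 * (2 * a * b) = (a*U - b*S)\<^sup>2 + (a*S - b*U)\<^sup>2"
      by (simp add: power2_eq_square algebra_simps)
    moreover have "P * (a - b)\<^sup>2 + (P - R) * (2 * a * b) = P * (a\<^sup>2 + b\<^sup>2) - R * (2 * a * b)"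
      by (simp add: power2_eq_square algebra_simps)
    moreover have "0 \<le> (a*S - b*U)\<^sup>2" by simp
    ultimately have 2: "P * (a\<^sup>2 + b\<^sup>2) - R * (2 * a * b) \<ge> (a*U - b*S)\<^sup>2" by linarith
    show ?thesis using insert 1 2
      by (simp add: P_def R_def U_def S_def a_def b_def mult.commute mult.left_commute)
  qed
qed simp

text \<open>This is the sign of the expectation in the twin case, a cluster \<open>i\<close> contributing the
  weights \<open>u i\<close> and \<open>s i\<close> of being hit from the lower or from the upper copy of a
  twin only, and \<open>e i\<close> of being missed by at least one twin and attached to both copies of
  neither. Expanding the products over the set \<open>J\<close> of clusters that are hit by both twins reduces
  it to the preceding lemma.\<close>
lemma twin_polynomial_nonneg:
  fixes e u s :: "'i \<Rightarrow> real"
  assumes "finite I" "\<And>i. 0 \<le> e i" "\<And>i. 0 \<le> u i" "\<And>i. 0 \<le> s i"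
  shows "0 \<le> 2 * (\<Prod>i\<in>I. ((u i)\<^sup>2 + (s i)\<^sup>2) + e i) - 2 * (\<Prod>i\<in>I. 2 * u i * s i + e i)
     - (\<Prod>i\<in>I. (u i)\<^sup>2 + e i) - (\<Prod>i\<in>I. (s i)\<^sup>2 + e i) + 2 * (\<Prod>i\<in>I. u i * s i + e i)"
proof -
  let ?e = "\<lambda>J. prod e (I - J)"
  have "2 * (\<Prod>i\<in>I. ((u i)\<^sup>2 + (s i)\<^sup>2) + e i) - 2 * (\<Prod>i\<in>I. 2 * u i * s i + e i)
     - (\<Prod>i\<in>I. (u i)\<^sup>2 + e i) - (\<Prod>i\<in>I. (s i)\<^sup>2 + e i) + 2 * (\<Prod>i\<in>I. u i * s i + e i) =
     (\<Sum>J\<in>Pow I. (2 * (\<Prod>i\<in>J. (u i)\<^sup>2 + (s i)\<^sup>2) - 2 * (\<Prod>i\<in>J. 2 * u i * s i)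
       - (prod u J - prod s J)\<^sup>2) * ?e J)"
    unfolding prod_add[OF assms(1)] sum_distrib_left
    by (simp add: sum_subtractf[symmetric] sum.distrib[symmetric] algebra_simps power2_eq_square prod.distrib)
  also have "\<dots> \<ge> 0"
  proof (intro sum_nonneg mult_nonneg_nonneg prod_nonneg ballI)
    fix J assume "J \<in> Pow I"
    then have "finite J" using assms(1) finite_subset by auto
    from prod_squares_ge[OF this, of u s]
    have "(prod u J - prod s J)\<^sup>2 \<le> (\<Prod>i\<in>J. (u i)\<^sup>2 + (s i)\<^sup>2) - (\<Prod>i\<in>J. 2 * u i * s i)"
      using assms by simp
    moreover have "0 \<le> (prod u J - prod s J)\<^sup>2" by simp
    ultimately show "0 \<le> 2 * (\<Prod>i\<in>J. (u i)\<^sup>2 + (s i)\<^sup>2) - 2 * (\<Prod>i\<in>J. 2 * u i * s i)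
       - (prod u J - prod s J)\<^sup>2" by linarith
  qed (use assms in auto)
  finally show ?thesis .
qed

section \<open>Clusters and hubs\<close>

text \<open>Adjacency by edges of \<open>S\<close>, the set of open edges; its reflexive transitive closure
  \<open>joined S\<close> is connectivity.\<close>
definition edge_rel :: "'b set set \<Rightarrow> ('b \<times> 'b) set" where
  "edge_rel S = {(x, y). {x, y} \<in> S}"

abbreviation joined :: "'b set set \<Rightarrow> 'b \<Rightarrow> 'b \<Rightarrow> bool" where
  "joined S x y \<equiv> (x, y) \<in> (edge_rel S)\<^sup>*"

lemma joined_sym: "joined S x y \<Longrightarrow> joined S y x"
proof -
  have "sym (edge_rel S)" by (auto simp: sym_def edge_rel_def insert_commute)
  then show "joined S x y \<Longrightarrow> joined S y x" using sym_rtrancl symD by metis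
qed

lemma joined_mono: "joined S x y \<Longrightarrow> S \<subseteq> S' \<Longrightarrow> joined S' x y"
  by (erule rtrancl_mono[THEN subsetD, rotated]) (auto simp: edge_rel_def)

lemma joined_edge: "{x, y} \<in> S \<Longrightarrow> joined S x y"
  by (auto simp: edge_rel_def)

lemma joined_image_imp:
  assumes "inj f" "joined (image f ` S) (f x) b"
  shows "\<exists>y. b = f y \<and> joined S x y"
  using assms(2)
proof induction
  case (step a b)
  then obtain y where y: "a = f y" "joined S x y" by auto
  from step obtain e where e: "e \<in> S" "{f y, b} = f ` e" by (auto simp: edge_rel_def y)
  then obtain z where z: "b = f z" "z \<in> e" by blast
  have "f ` e = f ` {y, z}" using e z by simp
  then have "e = {y, z}" using assms(1) inj_image_eq_iff by metis
  with e have "joined S y z" by (intro joined_edge) simp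
  with y(2) have "joined S x z" by (rule rtrancl_trans)
  with z(1) show ?case by blast
qed auto

lemma joined_image:
  assumes "inj f"
  shows "joined (image f ` S) (f x) (f y) \<longleftrightarrow> joined S x y"
proof
  assume "joined S x y"
  then show "joined (image f ` S) (f x) (f y)"
  proof induction
    case (step y z)
    then have "{f y, f z} \<in> image f ` S" by (auto simp: edge_rel_def intro!: image_eqI[of _ _ "{y, z}"])
    with step show ?case by (meson joined_edge rtrancl_trans)
  qed simp
next
  assume "joined (image f ` S) (f x) (f y)"
  with joined_image_imp[OF assms] assms show "joined S x y" by (metis injD)
qed

text \<open>The edges that join each vertex \<open>h\<close> of \<open>H\<close> to the vertices of
  \<open>N h\<close>.\<close>
definition star_edges :: "('b \<Rightarrow> 'b set) \<Rightarrow> 'b set \<Rightarrow> 'b set set" where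
  "star_edges N H = {{h, z} | h z. h \<in> H \<and> z \<in> N h}"

text \<open>A set \<open>H\<close> of pairwise non-adjacent vertices, the hubs, each attached to vertices of a
  graph with edge set \<open>R\<close> that avoids \<open>H\<close>. Then two hubs are connected iff there is a
  chain of hubs in which consecutive ones are attached to a common cluster of \<open>R\<close>; the lemmas of
  the locale give the two directions of this in the form in which they are needed.\<close>
locale hubs =
  fixes R :: "'b set set" and H :: "'b set" and N :: "'b \<Rightarrow> 'b set"
  assumes R_avoids: "\<And>e. e \<in> R \<Longrightarrow> e \<inter> H = {}"
    and N_avoids: "\<And>h. N h \<inter> H = {}"
begin

abbreviation "S \<equiv> R \<union> star_edges N H"

text \<open>The hub \<open>h\<close> is attached to the \<open>R\<close>-cluster of \<open>z\<close>.\<close>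
definition hits :: "'b \<Rightarrow> 'b \<Rightarrow> bool" where
  "hits h z \<longleftrightarrow> (\<exists>y\<in>N h. joined R y z)"

lemma hits_joined: "hits h z \<Longrightarrow> h \<in> H \<Longrightarrow> joined S h z"
proof -
  assume "hits h z" "h \<in> H"
  then obtain y where "y \<in> N h" "joined R y z" by (auto simp: hits_def)
  have "joined S h y"
    using \<open>h \<in> H\<close> \<open>y \<in> N h\<close> by (intro joined_edge) (auto simp: star_edges_def)
  moreover have "joined S y z" using \<open>joined R y z\<close> by (rule joined_mono) auto
  ultimately show ?thesis by (rule rtrancl_trans)
qed

lemma hits_trans: "hits h z \<Longrightarrow> joined R z z' \<Longrightarrow> hits h z'"
  by (meson hits_def rtrancl_trans)

lemma hubs_joined: "hits h z \<Longrightarrow> hits h' z \<Longrightarrow> h \<in> H \<Longrightarrow> h' \<in> H \<Longrightarrow> joined S h h'"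
  by (meson hits_joined joined_sym rtrancl_trans)

text \<open>A set \<open>H'\<close> of hubs that shares no cluster with the remaining hubs is, together with
  the clusters attached to it, closed under open edges.\<close>
lemma joined_from_hubs:
  assumes "H' \<subseteq> H" and sep: "\<And>h h' z. h \<in> H' \<Longrightarrow> h' \<in> H - H' \<Longrightarrow> hits h z \<Longrightarrow> hits h' z \<Longrightarrow> False"
    and "x \<in> H'" "joined S x y"
  shows "y \<in> H' \<or> y \<notin> H \<and> (\<exists>h\<in>H'. hits h y)"
  using assms(4)
proof induction
  case (step y z)
  from step have "{y, z} \<in> S" by (auto simp: edge_rel_def)
  then consider "{y, z} \<in> R" | h w where "{y, z} = {h, w}" "h \<in> H" "w \<in> N h"
    by (auto simp: star_edges_def)
  then show ?case
  proof cases
    case 1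
    then have "y \<notin> H" "z \<notin> H" using R_avoids by auto
    then show ?thesis using step.IH 1 assms(1) by (meson hits_trans joined_edge subsetD)
  next
    case 2
    then have w: "w \<notin> H" "hits h w" using N_avoids by (auto simp: hits_def)
    from 2 consider "y = h" "z = w" | "y = w" "z = h" by (auto simp: doubleton_eq_iff)
    then show ?thesis
    proof cases
      case 1
      then show ?thesis using w 2 step.IH by auto
    next
      case 2
      then show ?thesis using w sep step.IH \<open>h \<in> H\<close> assms(1) by blast
    qed
  qed
qed (use assms in auto)

end

section \<open>Connection probabilities as expectations\<close>

text \<open>A simple open path exists as soon as the end points are related by the transitive closure.\<close>
lemma open_connected_iff_joined:
  assumes E: "\<Union>E \<subseteq> V" and S: "S \<subseteq> bunkbed_edges V E"
  shows "open_connected V E (\<lambda>e. e \<in> S) x y \<longleftrightarrow> x \<in> bunkbed_verts V \<and> joined S x y"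
proof -
  let ?r = "\<lambda>x y. {x, y} \<in> bunkbed_edges V E \<and> {x, y} \<in> S"
  have r: "?r = (\<lambda>x y. (x, y) \<in> edge_rel S)" using S by (auto simp: edge_rel_def fun_eq_iff)
  have path: "rtrancl_path ?r a xs b \<longleftrightarrow> successively ?r (a # xs) \<and> last (a # xs) = b" for a b xs
  proof (induction xs arbitrary: a)
    case Nil
    then show ?case by (auto intro: rtrancl_path.intros elim: rtrancl_path.cases)
  next
    case (Cons c xs)
    have "rtrancl_path ?r a (c # xs) b \<longleftrightarrow> ?r a c \<and> rtrancl_path ?r c xs b"
      by (blast intro: rtrancl_path.intros elim: rtrancl_path.cases)
    with Cons show ?case by simp
  qed
  have verts: "set (a # xs) \<subseteq> bunkbed_verts V" if "successively ?r (a # xs)" "a \<in> bunkbed_verts V" for a xs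
    using that
  proof (induction xs arbitrary: a)
    case (Cons c xs)
    then have "{a, c} \<in> bunkbed_edges V E" by auto
    then have "c \<in> bunkbed_verts V"
      using E by (auto simp: bunkbed_edges_def bunkbed_verts_def doubleton_eq_iff)
    with Cons.IH[of c] Cons.prems show ?case by auto
  qed auto
  show ?thesis
  proof
    assume "open_connected V E (\<lambda>e. e \<in> S) x y"
    then obtain xs where xs: "xs \<noteq> []" "set xs \<subseteq> bunkbed_verts V" "successively ?r xs" "hd xs = x" "last xs = y"
      by (auto simp: open_connected_def open_path_def)
    then obtain ys where "xs = x # ys" by (cases xs) auto
    with xs have "rtrancl_path ?r x ys y" unfolding path by simp
    then have "?r\<^sup>*\<^sup>* x y" unfolding rtranclp_eq_rtrancl_path by (rule exI)
    then show "x \<in> bunkbed_verts V \<and> joined S x y"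
      using xs \<open>xs = x # ys\<close> unfolding r by (simp add: rtranclp_rtrancl_eq)
  next
    assume *: "x \<in> bunkbed_verts V \<and> joined S x y"
    then have "?r\<^sup>*\<^sup>* x y" unfolding r by (simp add: rtranclp_rtrancl_eq)
    then obtain xs where "rtrancl_path ?r x xs y" unfolding rtranclp_eq_rtrancl_path by (rule exE)
    then obtain ys where ys: "rtrancl_path ?r x ys y" "distinct (x # ys)"
      by (rule rtrancl_path_distinct)
    then have "successively ?r (x # ys)" "last (x # ys) = y" unfolding path by auto
    then have "open_path V E (\<lambda>e. e \<in> S) (x # ys)"
      using ys verts * unfolding open_path_def by blast
    then show "open_connected V E (\<lambda>e. e \<in> S) x y"
      using \<open>last (x # ys) = y\<close> unfolding open_connected_def
      by (intro exI[of _ "x # ys"]) simp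
  qed
qed

lemma prob_Pi_pmf_bernoulli:
  assumes A: "finite A" and p: "p \<in> {0..1}"
  shows "measure_pmf.prob (Pi_pmf A False (\<lambda>_. bernoulli_pmf p)) {Z. Q Z} =
    bexp p A (\<lambda>S. of_bool (Q (\<lambda>e. e \<in> S)))"
proof -
  let ?M = "Pi_pmf A False (\<lambda>_. bernoulli_pmf p)"
  let ?f = "\<lambda>S e. e \<in> (S :: 'a set)"
  let ?C = "?f ` {S. S \<subseteq> A \<and> Q (?f S)}"
  have "measure_pmf.prob ?M {Z. Q Z} = measure_pmf.prob ?M ?C"
  proof (rule measure_eq_AE)
    show "AE Z in measure_pmf ?M. Z \<in> {Z. Q Z} \<longleftrightarrow> Z \<in> ?C"
    proof (rule AE_pmfI)
      fix Z assume "Z \<in> set_pmf ?M"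
      then have Z: "\<forall>e. e \<notin> A \<longrightarrow> Z e = False" using set_Pi_pmf_subset[OF A, of False "\<lambda>_. bernoulli_pmf p"] by blast
      have "Z = ?f {e. Z e}" by auto
      with Z show "Z \<in> {Z. Q Z} \<longleftrightarrow> Z \<in> ?C" by (auto intro!: image_eqI[of _ _ "{e. Z e}"])
    qed
  qed auto
  also have "\<dots> = sum (pmf ?M) ?C"
    using A by (intro measure_measure_pmf_finite finite_imageI) simp
  also have "\<dots> = (\<Sum>S | S \<subseteq> A \<and> Q (?f S). pmf ?M (?f S))"
    by (subst sum.reindex) (auto simp: inj_on_def fun_eq_iff)
  also have "\<dots> = (\<Sum>S | S \<subseteq> A \<and> Q (?f S). p ^ card S * (1 - p) ^ card (A - S))"
  proof (intro sum.cong refl, clarify)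
    fix S assume S: "S \<subseteq> A"
    then have "pmf ?M (?f S) = (\<Prod>e\<in>A. pmf (bernoulli_pmf p) (e \<in> S))"
      using A by (intro pmf_Pi') auto
    also have "\<dots> = (\<Prod>e\<in>A - S. pmf (bernoulli_pmf p) (e \<in> S)) * (\<Prod>e\<in>S. pmf (bernoulli_pmf p) (e \<in> S))"
      using S A by (intro prod.subset_diff)
    also have "\<dots> = (1 - p) ^ card (A - S) * p ^ card S" using p by simp
    finally show "pmf ?M (?f S) = p ^ card S * (1 - p) ^ card (A - S)" by simp
  qed
  also have "\<dots> = bexp p A (\<lambda>S. of_bool (Q (?f S)))"
    unfolding bexp_def using A by (intro sum.mono_neutral_cong_left) auto
  finally show ?thesis .
qed

lemma finite_bunkbed_edges:
  assumes "finite V" "\<Union>E \<subseteq> V"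
  shows "finite (bunkbed_edges V E)"
proof -
  have "bunkbed_edges V E \<subseteq> Pow (bunkbed_verts V)"
    using assms(2) by (auto simp: bunkbed_edges_def bunkbed_verts_def)
  moreover have "finite (bunkbed_verts V)" using assms(1) by (simp add: bunkbed_verts_def)
  ultimately show ?thesis by (meson finite_Pow_iff finite_subset)
qed

lemma conn_prob_eq:
  assumes "finite V" "\<Union>E \<subseteq> V" "p \<in> {0..1}" "x \<in> bunkbed_verts V"
  shows "conn_prob V E p x y = bexp p (bunkbed_edges V E) (\<lambda>S. of_bool (joined S x y))"
  unfolding conn_prob_def percolation_def
    prob_Pi_pmf_bernoulli[OF finite_bunkbed_edges[OF assms(1,2)] assms(3)]
  using open_connected_iff_joined[OF assms(2)] assms(4) by (intro bexp_cong) auto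

section \<open>Signed connections and symmetries\<close>

lemma UNIV_layer: "UNIV = {Plus, Minus}"
  using layer.exhaust by blast

fun flip :: "layer \<Rightarrow> layer" where
  "flip Plus = Minus" | "flip Minus = Plus"

text \<open>Connections of \<open>v\<close> and \<open>w\<close> within a layer minus connections between the
  layers. Its expectation is twice the difference of the two probabilities to be compared
  (\<open>conn_prob_le_iff\<close>).\<close>
definition signed_conn :: "('a \<times> layer) set set \<Rightarrow> 'a \<Rightarrow> 'a \<Rightarrow> real" where
  "signed_conn S v w =
     of_bool (joined S (v, Minus) (w, Minus)) + of_bool (joined S (v, Plus) (w, Plus))
     - of_bool (joined S (v, Minus) (w, Plus)) - of_bool (joined S (v, Plus) (w, Minus))"

lemma joined_cong_left:
  assumes "joined S x y"
  shows "joined S x z \<longleftrightarrow> joined S y z"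
proof
  show "joined S y z" if "joined S x z" using joined_sym[OF assms] that by (rule rtrancl_trans)
  show "joined S x z" if "joined S y z" using assms that by (rule rtrancl_trans)
qed

lemma joined_cong_right:
  assumes "joined S x y"
  shows "joined S z x \<longleftrightarrow> joined S z y"
proof
  show "joined S z y" if "joined S z x" using that assms by (rule rtrancl_trans)
  show "joined S z x" if "joined S z y" using that joined_sym[OF assms] by (rule rtrancl_trans)
qed

text \<open>Once the two copies of one of the end points are connected, the signed count cancels.\<close>
lemma signed_conn_zero_left:
  assumes "joined S (v, Minus) (v, Plus)"
  shows "signed_conn S v w = 0"
  unfolding signed_conn_def joined_cong_left[OF assms] by simp

lemma signed_conn_zero_right:
  assumes "joined S (w, Minus) (w, Plus)"
  shows "signed_conn S v w = 0"
  unfolding signed_conn_def joined_cong_right[OF assms] by simp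

lemma bexp_joined_auto:
  assumes "inj f" "image f ` A = A"
  shows "bexp p A (\<lambda>S. of_bool (joined S (f x) (f y))) = bexp p A (\<lambda>S. of_bool (joined S x y))"
proof -
  have "inj_on (image f) A" using assms(1) by (simp add: inj_on_def inj_image_eq_iff)
  from bexp_image[OF this, of p "\<lambda>S. of_bool (joined S (f x) (f y))"]
  show ?thesis by (simp add: assms joined_image)
qed

lemma bexp_signed_conn:
  "bexp p A (\<lambda>S. signed_conn S v w) =
     bexp p A (\<lambda>S. of_bool (joined S (v, Minus) (w, Minus)))
   + bexp p A (\<lambda>S. of_bool (joined S (v, Plus) (w, Plus)))
   - bexp p A (\<lambda>S. of_bool (joined S (v, Minus) (w, Plus)))
   - bexp p A (\<lambda>S. of_bool (joined S (v, Plus) (w, Minus)))"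
  unfolding signed_conn_def bexp_add bexp_diff ..

lemma bunkbed_edges_flip: "image (apsnd flip) ` bunkbed_edges V E = bunkbed_edges V E"
proof -
  have sub: "image (apsnd flip) ` bunkbed_edges V E \<subseteq> bunkbed_edges V E"
    by (auto simp: bunkbed_edges_def insert_commute)
  have "e = image (apsnd flip) (image (apsnd flip) e)" for e :: "('a \<times> layer) set"
  proof -
    have "flip (flip l) = l" for l by (cases l) auto
    then have "apsnd flip (apsnd flip z) = z" for z :: "'a \<times> layer" by (cases z) simp
    then show ?thesis by (simp add: image_image)
  qed
  then show ?thesis using sub by (metis (no_types, lifting) image_subset_iff imageI subsetI subset_antisym)
qed

lemma inj_flip: "inj (apsnd flip)"
proof -
  have "flip (flip l) = l" for l by (cases l) auto
  then show ?thesis by (metis inj_apsnd inj_on_inverseI)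
qed

lemma bunkbed_edges_apfst:
  assumes "bij g" "image g ` E = E" "g ` V = V"
  shows "image (apfst g) ` bunkbed_edges V E = bunkbed_edges V E"
proof -
  have sub: "image (apfst g) ` bunkbed_edges V E \<subseteq> bunkbed_edges V E"
    if "image g ` E \<subseteq> E" "g ` V \<subseteq> V" for g
  proof -
    have "{g a, g b} \<in> E" if "{a, b} \<in> E" for a b
    proof -
      have "g ` {a, b} \<in> E" using that \<open>image g ` E \<subseteq> E\<close> by blast
      then show ?thesis by simp
    qed
    moreover have "g a \<in> V" if "a \<in> V" for a using that \<open>g ` V \<subseteq> V\<close> by blast
    ultimately show ?thesis
      unfolding bunkbed_edges_def image_Un by (intro Un_mono subsetI; clarsimp; blast)
  qed
  let ?h = "inv g"
  have gh: "?h (g x) = x" "g (?h x) = x" for x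
    using assms(1) by (auto simp: bij_is_inj bij_is_surj surj_f_inv_f)
  have "image ?h ` E = image ?h ` image g ` E" by (simp add: assms)
  also have "\<dots> = E" by (simp add: image_image gh)
  finally have 1: "image ?h ` E \<subseteq> E" by simp
  have "?h ` V = ?h ` g ` V" by (simp add: assms)
  also have "\<dots> = V" by (simp add: image_image gh)
  finally have 2: "?h ` V \<subseteq> V" by simp
  have "e = image (apfst g) (image (apfst ?h) e)" for e :: "('a \<times> layer) set"
    by (simp add: image_image apfst_def map_prod_def case_prod_beta gh)
  then have "bunkbed_edges V E \<subseteq> image (apfst g) ` bunkbed_edges V E"
    using sub[OF 1 2] by (metis (no_types, lifting) image_subset_iff imageI subsetI)
  with sub[of g] assms show ?thesis by auto
qed

lemma bexp_signed_conn_auto: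
  assumes "bij g" "image g ` E = E" "g ` V = V"
  shows "bexp p (bunkbed_edges V E) (\<lambda>S. signed_conn S (g v) (g w)) =
    bexp p (bunkbed_edges V E) (\<lambda>S. signed_conn S v w)"
proof -
  have "inj (apfst g)" using assms(1) by (simp add: bij_is_inj)
  from bexp_joined_auto[OF this bunkbed_edges_apfst[OF assms], of p]
  have "bexp p (bunkbed_edges V E) (\<lambda>S. of_bool (joined S (g v, l) (g w, l'))) =
     bexp p (bunkbed_edges V E) (\<lambda>S. of_bool (joined S (v, l) (w, l')))" for l l'
    by (metis apfst_conv)
  then show ?thesis by (simp add: bexp_signed_conn)
qed

lemma conn_prob_le_iff:
  assumes "finite V" "\<Union>E \<subseteq> V" "p \<in> {0..1}" "v \<in> V"
  shows "conn_prob V E p (v, Minus) (w, Minus) \<ge> conn_prob V E p (v, Minus) (w, Plus)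
    \<longleftrightarrow> 0 \<le> bexp p (bunkbed_edges V E) (\<lambda>S. signed_conn S v w)"
proof -
  let ?B = "\<lambda>l l'. bexp p (bunkbed_edges V E) (\<lambda>S. of_bool (joined S (v, l) (w, l')))"
  have "?B (flip l) (flip l') = ?B l l'" for l l'
    using bexp_joined_auto[OF inj_flip bunkbed_edges_flip, of p V E "(v, l)" "(w, l')"] by simp
  from this[of Plus Plus] this[of Plus Minus]
  show ?thesis
    using assms by (simp add: conn_prob_eq bunkbed_verts_def bexp_signed_conn)
qed

section \<open>Two random stars\<close>

text \<open>The star of \<open>v\<close> is encoded by the set \<open>X\<close> of pairs
  \<open>(u, l)\<close> for which the edge between \<open>(v, l)\<close> and \<open>(u, l)\<close> is open.
  If \<open>X\<close> is restricted to one cluster, \<open>hit l X\<close> says that \<open>(v, l)\<close> is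
  attached to this cluster.\<close>
definition hit :: "layer \<Rightarrow> ('a \<times> layer) set \<Rightarrow> bool" where
  "hit l X \<longleftrightarrow> (\<exists>z\<in>X. snd z = l)"

text \<open>For the parts \<open>X\<close> and \<open>Y\<close> of two stars that lie in one cluster: neither
  star attaches both of its copies to the cluster, and the cluster links the copies in layers \<open>l\<close>
  and \<open>l'\<close> only if \<open>ok l l'\<close>.\<close>
definition compat :: "(layer \<Rightarrow> layer \<Rightarrow> bool) \<Rightarrow> ('a \<times> layer) set \<Rightarrow> ('a \<times> layer) set \<Rightarrow> bool" where
  "compat ok X Y \<longleftrightarrow> \<not> (hit Minus X \<and> hit Plus X) \<and> \<not> (hit Minus Y \<and> hit Plus Y)
     \<and> (\<forall>l l'. hit l X \<and> hit l' Y \<longrightarrow> ok l l')"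

lemma all_layer: "(\<forall>l. P l) \<longleftrightarrow> P Minus \<and> P Plus"
  by (metis layer.exhaust)

lemma prod_of_bool: "finite A \<Longrightarrow> (\<Prod>x\<in>A. of_bool (P x)) = (of_bool (\<forall>x\<in>A. P x) :: real)"
  by (induction A rule: finite_induct) auto

text \<open>With \<open>w i j c\<close> the probability that the lower copy is attached to the cluster
  \<open>c\<close> iff \<open>i\<close> and the upper one iff \<open>j\<close>, the probability that all
  clusters are compatible factorises over clusters.\<close>
lemma bexp_compat:
  fixes cl :: "'a \<times> layer \<Rightarrow> 'c" and p :: real
  assumes "finite M"
  defines "w \<equiv> \<lambda>i j c. bexp p {z\<in>M. cl z = c} (\<lambda>X. of_bool (hit Minus X = i \<and> hit Plus X = j))"
  defines "u \<equiv> w True False" and "s \<equiv> w False True" and "e \<equiv> \<lambda>c. (w False False c)\<^sup>2 +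
     2 * w False False c * w True False c + 2 * w False False c * w False True c"
  shows "bexp p M (\<lambda>X. bexp p M (\<lambda>Y.
      of_bool (\<forall>c\<in>cl ` M. compat ok {z\<in>X. cl z = c} {z\<in>Y. cl z = c}))) =
    (\<Prod>c\<in>cl ` M. of_bool (ok Minus Minus) * (u c)\<^sup>2 + of_bool (ok Plus Plus) * (s c)\<^sup>2
      + (of_bool (ok Minus Plus) + of_bool (ok Plus Minus)) * (u c * s c) + e c)"
proof -
  define I :: "bool \<Rightarrow> bool \<Rightarrow> ('a \<times> layer) set \<Rightarrow> real" where
    "I = (\<lambda>i j X. of_bool (hit Minus X = i \<and> hit Plus X = j))"
  have pt: "of_bool (compat ok X Y) =
      of_bool (ok Minus Minus) * (I True False X * I True False Y)
    + of_bool (ok Plus Plus) * (I False True X * I False True Y)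
    + of_bool (ok Minus Plus) * (I True False X * I False True Y)
    + of_bool (ok Plus Minus) * (I False True X * I True False Y)
    + I False False X * I False False Y
    + I False False X * I True False Y
    + I False False X * I False True Y
    + I True False X * I False False Y
    + I False True X * I False False Y" for X Y
    unfolding compat_def all_layer I_def
    by (cases "hit Minus X"; cases "hit Plus X"; cases "hit Minus Y"; cases "hit Plus Y") auto
  have w: "bexp p {z\<in>M. cl z = c} (I i j) = w i j c" for i j c
    by (simp add: w_def I_def)
  have "bexp p M (\<lambda>X. bexp p M (\<lambda>Y.
      of_bool (\<forall>c\<in>cl ` M. compat ok {z\<in>X. cl z = c} {z\<in>Y. cl z = c}))) =
    bexp p M (\<lambda>X. bexp p M (\<lambda>Y.
      \<Prod>c\<in>cl ` M. of_bool (compat ok {z\<in>X. cl z = c} {z\<in>Y. cl z = c})))"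
    using assms(1) by (subst prod_of_bool) auto
  also have "\<dots> = bexp p M (\<lambda>X. \<Prod>c\<in>cl ` M. bexp p {z\<in>M. cl z = c}
      (\<lambda>Y. of_bool (compat ok {z\<in>X. cl z = c} Y)))"
    by (subst bexp_clusters[OF assms(1)]) (rule refl)
  also have "\<dots> = (\<Prod>c\<in>cl ` M. bexp p {z\<in>M. cl z = c} (\<lambda>X. bexp p {z\<in>M. cl z = c}
      (\<lambda>Y. of_bool (compat ok X Y))))"
    by (subst bexp_clusters[OF assms(1), symmetric]) (rule refl)
  also have "\<dots> = (\<Prod>c\<in>cl ` M. of_bool (ok Minus Minus) * (u c)\<^sup>2 + of_bool (ok Plus Plus) * (s c)\<^sup>2
      + (of_bool (ok Minus Plus) + of_bool (ok Plus Minus)) * (u c * s c) + e c)"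
    unfolding pt bexp_add bexp_cmult bexp_multc w u_def s_def e_def
    by (intro prod.cong refl) (simp add: power2_eq_square algebra_simps)
  finally show ?thesis .
qed

text \<open>The integrand is the signed count of the twins; see \<open>signed_conn_two_stars\<close>.\<close>
lemma twin_kernel_nonneg:
  fixes cl :: "'a \<times> layer \<Rightarrow> 'c" and p :: real
  assumes "finite M" "p \<in> {0..1}"
  defines "k \<equiv> \<lambda>ok X Y. of_bool (\<forall>c\<in>cl ` M. compat ok {z\<in>X. cl z = c} {z\<in>Y. cl z = c}) :: real"
  shows "0 \<le> bexp p M (\<lambda>X. bexp p M (\<lambda>Y. 2 * k (=) X Y - 2 * k (\<noteq>) X Y
     - k (\<lambda>l l'. l = Minus \<and> l' = Minus) X Y - k (\<lambda>l l'. l = Plus \<and> l' = Plus) X Y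
     + k (\<lambda>l l'. l = Minus \<and> l' = Plus) X Y + k (\<lambda>l l'. l = Plus \<and> l' = Minus) X Y))"
proof -
  define w where "w \<equiv> \<lambda>i j c. bexp p {z\<in>M. cl z = c} (\<lambda>X. of_bool (hit Minus X = i \<and> hit Plus X = j))"
  define u s where "u = w True False" and "s = w False True"
  define e where "e = (\<lambda>c. (w False False c)\<^sup>2 +
     2 * w False False c * w True False c + 2 * w False False c * w False True c)"
  have w: "0 \<le> w i j c" for i j c
    unfolding w_def using assms(2) by (intro bexp_nonneg) auto
  have "0 \<le> 2 * (\<Prod>i\<in>cl ` M. ((u i)\<^sup>2 + (s i)\<^sup>2) + e i) - 2 * (\<Prod>i\<in>cl ` M. 2 * u i * s i + e i)
     - (\<Prod>i\<in>cl ` M. (u i)\<^sup>2 + e i) - (\<Prod>i\<in>cl ` M. (s i)\<^sup>2 + e i)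
     + 2 * (\<Prod>i\<in>cl ` M. u i * s i + e i)"
    by (intro twin_polynomial_nonneg) (use assms w in \<open>auto simp: u_def s_def e_def\<close>)
  moreover have "bexp p M (\<lambda>X. bexp p M (\<lambda>Y. k ok X Y)) =
    (\<Prod>c\<in>cl ` M. of_bool (ok Minus Minus) * (u c)\<^sup>2 + of_bool (ok Plus Plus) * (s c)\<^sup>2
      + (of_bool (ok Minus Plus) + of_bool (ok Plus Minus)) * (u c * s c) + e c)" for ok
    unfolding k_def u_def s_def e_def w_def by (rule bexp_compat[OF assms(1)])
  ultimately show ?thesis
    unfolding bexp_add bexp_diff bexp_cmult by (simp add: mult.assoc)
qed

section \<open>Stars in the bunkbed graph\<close>

text \<open>The edge from \<open>v\<close>, in the layer of \<open>z\<close>, to \<open>z\<close>.\<close>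
definition link :: "'a \<Rightarrow> 'a \<times> layer \<Rightarrow> ('a \<times> layer) set" where
  "link v z = {(v, snd z), z}"

text \<open>The neighbourhood of \<open>v\<close> in the graph with edge set \<open>E\<close>.\<close>
definition nbrs :: "'a set set \<Rightarrow> 'a \<Rightarrow> 'a set" where
  "nbrs E v = {x. {v, x} \<in> E}"

lemma link_image: "link v ` X = {{(v, l), z} | l z. z \<in> X \<and> snd z = l}"
  unfolding link_def image_def by blast

lemma inj_on_link: "\<forall>z\<in>M. fst z \<noteq> v \<Longrightarrow> inj_on (link v) M"
  by (auto simp: inj_on_def link_def doubleton_eq_iff)

text \<open>For an independent set \<open>U\<close> of vertices, the bunkbed edges are those that avoid both
  copies of \<open>U\<close>, the vertical edges at \<open>U\<close>, and the horizontal stars of the vertices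
  of \<open>U\<close>.\<close>
lemma bunkbed_edges_split:
  assumes "U \<subseteq> V" "\<And>u u'. u \<in> U \<Longrightarrow> u' \<in> U \<Longrightarrow> {u, u'} \<notin> E"
  shows "bunkbed_edges V E = {e \<in> bunkbed_edges V E. e \<inter> U \<times> UNIV = {}} \<union>
     (\<lambda>u. {(u, Plus), (u, Minus)}) ` U \<union> (\<Union>u\<in>U. link u ` (nbrs E u \<times> UNIV))"
    (is "?E = ?R \<union> ?P \<union> ?L")
proof
  have L: "{(a, l), (b, l)} \<in> ?R \<union> ?L" if "{(a, l), (b, l)} \<in> ?E" "{a, b} \<in> E" for a b l
  proof -
    consider "a \<in> U" | "b \<in> U" | "a \<notin> U" "b \<notin> U" by blast
    then show ?thesis
    proof cases
      case 1
      then have "{(a, l), (b, l)} = link a (b, l)" "(b, l) \<in> nbrs E a \<times> UNIV"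
        using that by (auto simp: link_def nbrs_def)
      with 1 show ?thesis by blast
    next
      case 2
      then have "{(a, l), (b, l)} = link b (a, l)" "(a, l) \<in> nbrs E b \<times> UNIV"
        using that by (auto simp: link_def nbrs_def insert_commute)
      with 2 show ?thesis by blast
    next
      case 3
      with that show ?thesis by simp
    qed
  qed
  show "?E \<subseteq> ?R \<union> ?P \<union> ?L"
  proof
    fix e assume e: "e \<in> ?E"
    then consider a b l where "e = {(a, l), (b, l)}" "{a, b} \<in> E" |
      u where "u \<in> V" "e = {(u, Plus), (u, Minus)}"
      unfolding bunkbed_edges_def by blast
    then show "e \<in> ?R \<union> ?P \<union> ?L"
    proof cases
      case 1
      with L[of a l b] e show ?thesis by auto
    next
      case 2
      with e show ?thesis by (cases "u \<in> U") auto
    qed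
  qed
  have "link u (x, l) \<in> ?E" if "x \<in> nbrs E u" for u x l
    using that by (cases l) (auto simp: link_def nbrs_def bunkbed_edges_def)
  then have "?L \<subseteq> ?E" by auto
  moreover have "?P \<subseteq> ?E" using assms(1) by (auto simp: bunkbed_edges_def)
  ultimately show "?R \<union> ?P \<union> ?L \<subseteq> ?E" by blast
qed

lemma cluster_eq_iff: "(edge_rel R)\<^sup>* `` {y} = (edge_rel R)\<^sup>* `` {z} \<longleftrightarrow> joined R y z"
  using joined_sym[of _ _ R] by (auto intro: rtrancl_trans)

section \<open>Twins\<close>

text \<open>Let \<open>D l l'\<close> say that some cluster is attached to both \<open>(v, l)\<close> and
  \<open>(w, l')\<close>. If some cluster is attached to both copies of \<open>v\<close>, or of
  \<open>w\<close>, both sides vanish. Otherwise the clusters link the four copies in a bipartite pattern, and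
  \<open>(v, l)\<close> reaches \<open>(w, l')\<close> either directly or through the three other pairs. The
  term for \<open>ok\<close> is the indicator that \<open>D\<close> is contained in \<open>ok\<close>, and the
  identity is checked over the sixteen possible patterns \<open>D\<close>.\<close>
lemma signed_conn_two_stars:
  assumes "v \<noteq> w" and R: "\<And>e. e \<in> R \<Longrightarrow> e \<inter> {v, w} \<times> UNIV = {}"
    and M: "M \<inter> {v, w} \<times> UNIV = {}" and XY: "X \<subseteq> M" "Y \<subseteq> M"
  defines "cl \<equiv> \<lambda>z. (edge_rel R)\<^sup>* `` {z}"
  defines "k \<equiv> \<lambda>ok. of_bool (\<forall>c\<in>cl ` M. compat ok {z\<in>X. cl z = c} {z\<in>Y. cl z = c}) :: real"
  shows "signed_conn (R \<union> link v ` X \<union> link w ` Y) v w = 2 * k (=) - 2 * k (\<noteq>)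
     - k (\<lambda>l l'. l = Minus \<and> l' = Minus) - k (\<lambda>l l'. l = Plus \<and> l' = Plus)
     + k (\<lambda>l l'. l = Minus \<and> l' = Plus) + k (\<lambda>l l'. l = Plus \<and> l' = Minus)"
proof -
  define N where "N = (\<lambda>h. if fst h = v then {z\<in>X. snd z = snd h}
     else if fst h = w then {z\<in>Y. snd z = snd h} else {})"
  define H :: "('a \<times> layer) set" where "H = {v, w} \<times> UNIV"
  interpret hubs R H N
    by standard (use R M XY in \<open>auto simp: H_def N_def\<close>)
  have star: "star_edges N H = link v ` X \<union> link w ` Y"
  proof -
    have "star_edges N H = {{(v, l), z} | l z. z \<in> N (v, l)} \<union> {{(w, l), z} | l z. z \<in> N (w, l)}"
      unfolding star_edges_def H_def by blast
    also have "{{(v, l), z} | l z. z \<in> N (v, l)} = link v ` X"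
      by (simp add: N_def link_image)
    also have "{{(w, l), z} | l z. z \<in> N (w, l)} = link w ` Y"
      using \<open>v \<noteq> w\<close> by (simp add: N_def link_image)
    finally show ?thesis .
  qed
  define D where "D = (\<lambda>h h'. \<exists>z. hits h z \<and> hits h' z)"
  have hitX: "hit l {z\<in>X. cl z = cl m} \<longleftrightarrow> hits (v, l) m" for l m
    unfolding hit_def hits_def by (auto simp: N_def cl_def cluster_eq_iff)
  have hitY: "hit l {z\<in>Y. cl z = cl m} \<longleftrightarrow> hits (w, l) m" for l m
    using \<open>v \<noteq> w\<close> unfolding hit_def hits_def by (auto simp: N_def cl_def cluster_eq_iff)
  have DM: "D h h' \<longleftrightarrow> (\<exists>m\<in>M. hits h m \<and> hits h' m)" for h h'
  proof
    assume "D h h'"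
    then obtain z where z: "hits h z" "hits h' z" by (auto simp: D_def)
    then obtain y where y: "y \<in> N h" "joined R y z" by (auto simp: hits_def)
    then have "y \<in> M" using XY by (auto simp: N_def split: if_splits)
    moreover have "hits h y" "hits h' y" using z hits_trans[OF _ joined_sym[OF y(2)]] by auto
    ultimately show "\<exists>m\<in>M. hits h m \<and> hits h' m" by blast
  qed (auto simp: D_def)
  have k: "k ok = of_bool (\<not> D (v, Minus) (v, Plus) \<and> \<not> D (w, Minus) (w, Plus) \<and>
      (\<forall>l l'. D (v, l) (w, l') \<longrightarrow> ok l l'))" for ok
    unfolding k_def by (rule arg_cong[where f = of_bool]) (simp add: compat_def hitX hitY DM, blast)
  have Dsym: "D h h' \<longleftrightarrow> D h' h" for h h' by (auto simp: D_def)
  have inH: "(v, l) \<in> H" "(w, l) \<in> H" for l by (simp_all add: H_def)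
  have DS: "joined S h h'" if "D h h'" "h \<in> H" "h' \<in> H" for h h'
    using that hubs_joined unfolding D_def by blast
  have sep: "\<not> joined S x y" if "H' \<subseteq> H" "x \<in> H'" "y \<in> H - H'" "\<And>h h'. h \<in> H' \<Longrightarrow> h' \<in> H - H' \<Longrightarrow> \<not> D h h'" for H' x y
  proof
    assume "joined S x y"
    with that have "y \<in> H' \<or> y \<notin> H \<and> (\<exists>h\<in>H'. hits h y)"
      by (intro joined_from_hubs[of H' x y]) (auto simp: D_def)
    with that show False by blast
  qed
  show ?thesis
  proof (cases "D (v, Minus) (v, Plus) \<or> D (w, Minus) (w, Plus)")
    case True
    then have "signed_conn S v w = 0"
      using DS[of "(v, Minus)" "(v, Plus)"] DS[of "(w, Minus)" "(w, Plus)"]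
      by (auto simp: H_def intro: signed_conn_zero_left signed_conn_zero_right)
    moreover have "k ok = 0" for ok using True by (auto simp: k)
    ultimately show ?thesis by (simp add: star Un_assoc)
  next
    case False
    have conn: "joined S (v, l) (w, l') \<longleftrightarrow>
        D (v, l) (w, l') \<or> D (v, l) (w, m') \<and> D (v, m) (w, m') \<and> D (v, m) (w, l')"
      (is "_ \<longleftrightarrow> ?direct \<or> ?detour") if "m = flip l" "m' = flip l'" for l l' m m'
    proof
      assume "?direct \<or> ?detour"
      then show "joined S (v, l) (w, l')"
      proof
        assume ?detour
        then have "joined S (v, l) (w, m')" "joined S (w, m') (v, m)" "joined S (v, m) (w, l')"
          using DS Dsym inH by blast+
        then show ?thesis by (meson rtrancl_trans)
      qed (use DS inH in blast)
    next
      assume joined: "joined S (v, l) (w, l')"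
      have H: "H = {(v, l), (v, m), (w, l'), (w, m')}"
        using that by (cases l; cases l') (auto simp: H_def UNIV_layer)
      have ne: "l \<noteq> m" "l' \<noteq> m'" using that by (cases l; cases l'; simp)+
      have ov: "\<not> D (v, l) (v, m)" "\<not> D (v, m) (v, l)" "\<not> D (w, l') (w, m')" "\<not> D (w, m') (w, l')"
        using False that by (cases l; cases l'; simp add: Dsym)+
      show "?direct \<or> ?detour"
      proof (rule ccontr)
        assume neg: "\<not> (?direct \<or> ?detour)"
        then consider "\<not> D (v, l) (w, m')" | "\<not> D (v, m) (w, m')" | "\<not> D (v, m) (w, l')"
          by blast
        then show False
        proof cases
          case 1
          show False
            by (rule sep[THEN notE, OF _ _ _ _ joined, of "{(v, l)}"])
              (use 1 neg ov ne \<open>v \<noteq> w\<close> in \<open>auto simp: H\<close>)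
        next
          case 2
          show False
            by (rule sep[THEN notE, OF _ _ _ _ joined, of "{(v, l), (w, m')}"])
              (use 2 neg ov ne \<open>v \<noteq> w\<close> in \<open>auto simp: H Dsym\<close>)
        next
          case 3
          show False
            by (rule sep[THEN notE, OF _ _ _ _ joined, of "{(v, l), (v, m), (w, m')}"])
              (use 3 neg ov ne \<open>v \<noteq> w\<close> in \<open>auto simp: H Dsym\<close>)
        qed
      qed
    qed
    have "signed_conn S v w = 2 * k (=) - 2 * k (\<noteq>)
     - k (\<lambda>l l'. l = Minus \<and> l' = Minus) - k (\<lambda>l l'. l = Plus \<and> l' = Plus)
     + k (\<lambda>l l'. l = Minus \<and> l' = Plus) + k (\<lambda>l l'. l = Plus \<and> l' = Minus)"
      unfolding signed_conn_def k all_layer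
        conn[of Plus Minus Plus Minus, simplified] conn[of Minus Plus Minus Plus, simplified]
        conn[of Plus Minus Minus Plus, simplified] conn[of Minus Plus Plus Minus, simplified]
      using False
      by (cases "D (v, Minus) (w, Minus)"; cases "D (v, Minus) (w, Plus)";
          cases "D (v, Plus) (w, Minus)"; cases "D (v, Plus) (w, Plus)") simp_all
    then show ?thesis by (simp add: star Un_assoc)
  qed
qed

lemma twins_signed_conn_nonneg:
  assumes V: "finite V" "\<Union>E \<subseteq> V" and p: "p \<in> {0..1}"
    and vw: "v \<in> V" "w \<in> V" "v \<noteq> w" "nbrs E v = nbrs E w" and loop: "{v} \<notin> E" "{w} \<notin> E"
  shows "0 \<le> bexp p (bunkbed_edges V E) (\<lambda>S. signed_conn S v w)"
proof -
  define R where "R = {e \<in> bunkbed_edges V E. e \<inter> {v, w} \<times> UNIV = {}}"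
  \<comment> \<open>condition on the edges \<open>R\<close> away from the twins and on the two vertical edges \<open>P\<close>\<close>
  define P where "P = {{(v, Plus), (v, Minus)}, {(w, Plus), (w, Minus)}}"
  define M where "M = nbrs E v \<times> (UNIV :: layer set)"
  have nvw: "v \<notin> nbrs E v" "w \<notin> nbrs E v" "v \<notin> nbrs E w"
  proof -
    have "{v, x} \<in> E \<longleftrightarrow> {w, x} \<in> E" for x using vw(4) by (auto simp: nbrs_def set_eq_iff)
    from this[of v] this[of w] loop show "v \<notin> nbrs E v" "w \<notin> nbrs E v" "v \<notin> nbrs E w"
      by (simp_all add: nbrs_def insert_commute)
  qed
  then have M: "M \<inter> {v, w} \<times> UNIV = {}" by (auto simp: M_def)
  have "{u, u'} \<notin> E" if "u \<in> {v, w}" "u' \<in> {v, w}" for u u'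
    using that loop nvw by (auto simp: nbrs_def insert_commute)
  from bunkbed_edges_split[of "{v, w}" V E, OF _ this] vw
  have EE: "bunkbed_edges V E = R \<union> (P \<union> (link v ` M \<union> link w ` M))"
    by (simp add: R_def P_def M_def Un_ac insert_commute)
  have fin: "finite (bunkbed_edges V E)"
    using V by (rule finite_bunkbed_edges)
  have finM: "finite M"
    using finite_subset[of "nbrs E v" V] V by (auto simp: M_def nbrs_def UNIV_layer)
  have inj: "inj_on (link v) M" "inj_on (link w) M"
    using M by (auto intro!: inj_on_link)
  have disj: "link v ` M \<inter> link w ` M = {}"
    using M vw(3) by (auto simp: link_def doubleton_eq_iff)
  have "bexp p (bunkbed_edges V E) (\<lambda>S. signed_conn S v w) =
    bexp p R (\<lambda>S. bexp p (P \<union> (link v ` M \<union> link w ` M)) (\<lambda>T. signed_conn (S \<union> T) v w))"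
    unfolding EE using fin M finM by (intro bexp_union) (auto simp: R_def P_def link_def)
  also have "\<dots> = bexp p R (\<lambda>S. bexp p P (\<lambda>Q. bexp p (link v ` M \<union> link w ` M)
      (\<lambda>T. signed_conn (S \<union> (Q \<union> T)) v w)))"
    using M finM by (intro bexp_cong bexp_union) (auto simp: P_def link_def doubleton_eq_iff)
  also have "\<dots> = bexp p R (\<lambda>S. bexp p P (\<lambda>Q. bexp p M (\<lambda>X. bexp p M
      (\<lambda>Y. signed_conn (S \<union> (Q \<union> (link v ` X \<union> link w ` Y))) v w))))"
    by (simp add: bexp_union finM disj bexp_image inj)
  also have "\<dots> \<ge> 0"
  proof (rule bexp_nonneg[OF p], rule bexp_nonneg[OF p])
    fix S Q assume S: "S \<subseteq> R" and Q: "Q \<subseteq> P"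
    show "0 \<le> bexp p M (\<lambda>X. bexp p M (\<lambda>Y. signed_conn (S \<union> (Q \<union> (link v ` X \<union> link w ` Y))) v w))"
    proof (cases "Q = {}")
      case True
      let ?cl = "\<lambda>z. (edge_rel S)\<^sup>* `` {z}"
      have "\<And>e. e \<in> S \<Longrightarrow> e \<inter> {v, w} \<times> UNIV = {}" using S by (auto simp: R_def)
      note eq = signed_conn_two_stars[OF vw(3) this M]
      show ?thesis
        using twin_kernel_nonneg[OF finM p, of ?cl] True
        by (simp add: Un_assoc[symmetric] eq cong: bexp_cong)
    next
      case False
      with Q have "{(v, Minus), (v, Plus)} \<in> Q \<or> {(w, Minus), (w, Plus)} \<in> Q"
        by (auto simp: P_def insert_commute)
      then have "signed_conn (S \<union> (Q \<union> T)) v w = 0" for T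
      proof
        assume "{(v, Minus), (v, Plus)} \<in> Q"
        then show ?thesis by (intro signed_conn_zero_left joined_edge) simp
      next
        assume "{(w, Minus), (w, Plus)} \<in> Q"
        then show ?thesis by (intro signed_conn_zero_right joined_edge) simp
      qed
      then show ?thesis using finM by simp
    qed
  qed
  finally show ?thesis .
qed

section \<open>Sums over a neighbourhood\<close>

text \<open>If some cluster is attached to both copies of \<open>v\<close>, both sides vanish; otherwise
  \<open>(v, l)\<close> is connected to \<open>z\<close> iff it is attached to the cluster of \<open>z\<close>.
  In this cluster the factor is a difference of indicators, which also vanishes when both copies of
  \<open>v\<close> are attached to it.\<close>
lemma star_connection_diff:
  assumes R: "\<And>e. e \<in> R \<Longrightarrow> e \<inter> {v} \<times> UNIV = {}" and fin: "finite M"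
    and M: "M \<inter> {v} \<times> UNIV = {}" and X: "X \<subseteq> M" and z: "z \<in> M"
  defines "cl \<equiv> \<lambda>z. (edge_rel R)\<^sup>* `` {z}"
  defines "S \<equiv> R \<union> link v ` X"
  shows "of_bool (joined S (v, Minus) z) - of_bool (joined S (v, Plus) z) =
     (\<Prod>c\<in>cl ` M. if c = cl z then of_bool (hit Minus {y\<in>X. cl y = c}) - of_bool (hit Plus {y\<in>X. cl y = c})
       else of_bool (\<not> (hit Minus {y\<in>X. cl y = c} \<and> hit Plus {y\<in>X. cl y = c})) :: real)"
    (is "_ = (\<Prod>c\<in>cl ` M. ?f c)")
proof -
  define N where "N = (\<lambda>h. if fst h = v then {z\<in>X. snd z = snd h} else {})"
  define H :: "('a \<times> layer) set" where "H = {v} \<times> UNIV"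
  interpret hubs R H N
    rewrites S: "R \<union> star_edges N H = S"
  proof -
    show "hubs R H N"
      by standard (use R M X in \<open>auto simp: H_def N_def\<close>)
    have "star_edges N H = link v ` X"
      unfolding star_edges_def link_image by (simp add: H_def N_def; blast)
    then show "R \<union> star_edges N H = S" by (simp add: S_def)
  qed
  have hitX: "hit l {z\<in>X. cl z = cl m} \<longleftrightarrow> hits (v, l) m" for l m
    unfolding hit_def hits_def by (auto simp: N_def cl_def cluster_eq_iff)
  have hub: "(v, l) \<in> H" for l by (simp add: H_def)
  have zH: "z \<notin> H" using z M by (auto simp: H_def)
  show ?thesis
  proof (cases "\<exists>m. hits (v, Minus) m \<and> hits (v, Plus) m")
    case True
    then obtain m where m: "hits (v, Minus) m" "hits (v, Plus) m" by blast
    then obtain y where "y \<in> N (v, Minus)" "joined R y m" by (auto simp: hits_def)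
    then have y: "hits (v, Minus) y" "hits (v, Plus) y" "y \<in> M"
      using m hits_trans[OF _ joined_sym[of y m R]] X by (auto simp: N_def)
    then have "hit Minus {x\<in>X. cl x = cl y}" "hit Plus {x\<in>X. cl x = cl y}" by (simp_all add: hitX)
    then have "?f (cl y) = 0" by (simp only:) simp
    then have "\<exists>c\<in>cl ` M. ?f c = 0" by (rule bexI) (use y in blast)
    then have "(\<Prod>c\<in>cl ` M. ?f c) = 0" by (rule prod_zero[OF finite_imageI[OF fin]])
    moreover have "joined S (v, Minus) (v, Plus)"
      using hubs_joined[OF m] hub by simp
    ultimately show ?thesis by (simp add: joined_cong_left)
  next
    case False
    have "joined S (v, l) z \<longleftrightarrow> hits (v, l) z" for l
    proof
      assume j: "joined S (v, l) z"
      have "z \<in> {(v, l)} \<or> z \<notin> H \<and> (\<exists>h\<in>{(v, l)}. hits h z)"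
      proof (rule joined_from_hubs[OF _ _ _ j])
        fix h h' m assume "h \<in> {(v, l)}" "h' \<in> H - {(v, l)}" "hits h m" "hits h' m"
        then show False using False by (cases l; auto simp: H_def UNIV_layer simp del: split_paired_Ex split_paired_All)
      qed (auto simp: H_def)
      then show "hits (v, l) z" using zH hub by auto
    qed (use hits_joined hub in auto)
    moreover have "(\<Prod>c\<in>cl ` M. ?f c) = ?f (cl z)"
    proof -
      have "(\<Prod>c\<in>cl ` M. ?f c) = ?f (cl z) * (\<Prod>c\<in>cl ` M - {cl z}. ?f c)"
        using fin z by (intro prod.remove) auto
      also have "(\<Prod>c\<in>cl ` M - {cl z}. ?f c) = 1"
        using False by (intro prod.neutral) (auto simp: hitX)
      finally show ?thesis by simp
    qed
    ultimately show ?thesis by (simp add: hitX)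
  qed
qed

definition layer_sign :: "layer \<Rightarrow> real" where
  "layer_sign l = (if l = Minus then 1 else - 1)"

lemma bexp_hit:
  assumes "finite B"
  shows "bexp p B (\<lambda>X. of_bool (hit l X)) = 1 - (1 - p) ^ card {z\<in>B. snd z = l}"
proof -
  have "bexp p B (\<lambda>X. of_bool (hit l X)) = bexp p B (\<lambda>X. 1 - of_bool (X \<inter> {z\<in>B. snd z = l} = {}))"
    by (intro bexp_cong) (auto simp: hit_def)
  also have "\<dots> = 1 - (1 - p) ^ card {z\<in>B. snd z = l}"
    using assms by (simp add: bexp_diff bexp_avoid)
  finally show ?thesis .
qed

lemma sum_layer_sign:
  assumes "finite B"
  shows "(\<Sum>z\<in>B. layer_sign (snd z)) =
     real (card {z\<in>B. snd z = Minus}) - real (card {z\<in>B. snd z = Plus})"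
proof -
  have "(\<Sum>z\<in>B. layer_sign (snd z)) =
      (\<Sum>z\<in>B. of_bool (snd z = Minus) - of_bool (snd z = Plus))"
    by (intro sum.cong refl) (auto simp: layer_sign_def intro: layer.exhaust)
  then show ?thesis using assms by (simp add: sum_subtractf Int_def)
qed

text \<open>The copy of \<open>v\<close> in the layer that has more of the possible neighbours in a cluster is
  at least as likely as the other copy to be attached to the cluster.\<close>
lemma cluster_sign_product_nonneg:
  assumes "finite B" "p \<in> {0..1}"
  shows "0 \<le> (\<Sum>z\<in>B. layer_sign (snd z)) *
     bexp p B (\<lambda>X. of_bool (hit Minus X) - of_bool (hit Plus X))"
proof -
  let ?m = "card {z\<in>B. snd z = Minus}" and ?n = "card {z\<in>B. snd z = Plus}"
  have "0 \<le> (real ?m - real ?n) * ((1 - p) ^ ?n - (1 - p) ^ ?m)"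
  proof (cases "?n \<le> ?m")
    case True
    then have "(1 - p) ^ ?m \<le> (1 - p) ^ ?n" using assms(2) by (intro power_decreasing) auto
    with True show ?thesis by (intro mult_nonneg_nonneg) auto
  next
    case False
    then have "(1 - p) ^ ?n \<le> (1 - p) ^ ?m" using assms(2) by (intro power_decreasing) auto
    with False show ?thesis by (intro mult_nonpos_nonpos) auto
  qed
  then show ?thesis by (simp add: bexp_diff bexp_hit sum_layer_sign assms)
qed

text \<open>The sum is grouped by clusters. The expectation of each summand factorises over clusters by
  independence, with factor \<open>d c\<close> at the cluster \<open>c\<close> of \<open>z\<close> and
  \<open>q c'\<close> at every other one.\<close>
lemma star_sum_nonneg:
  fixes cl :: "'a \<times> layer \<Rightarrow> 'c" and p :: real
  assumes fin: "finite M" and p: "p \<in> {0..1}"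
  shows "0 \<le> bexp p M (\<lambda>X. \<Sum>z\<in>M. layer_sign (snd z) * (\<Prod>c\<in>cl ` M.
     if c = cl z then of_bool (hit Minus {y\<in>X. cl y = c}) - of_bool (hit Plus {y\<in>X. cl y = c})
       else of_bool (\<not> (hit Minus {y\<in>X. cl y = c} \<and> hit Plus {y\<in>X. cl y = c}))))"
proof -
  let ?B = "\<lambda>c. {z\<in>M. cl z = c}"
  define d where "d = (\<lambda>c. bexp p (?B c) (\<lambda>X. of_bool (hit Minus X) - of_bool (hit Plus X)))"
  define q where "q = (\<lambda>c. bexp p (?B c) (\<lambda>X. of_bool (\<not> (hit Minus X \<and> hit Plus X))))"
  have q: "0 \<le> q c" for c unfolding q_def using p by (intro bexp_nonneg) auto
  have "bexp p M (\<lambda>X. \<Prod>c\<in>cl ` M.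
     if c = cl z then of_bool (hit Minus {y\<in>X. cl y = c}) - of_bool (hit Plus {y\<in>X. cl y = c})
       else of_bool (\<not> (hit Minus {y\<in>X. cl y = c} \<and> hit Plus {y\<in>X. cl y = c}))) =
     d (cl z) * (\<Prod>c\<in>cl ` M - {cl z}. q c)" (is "?l = _") if z: "z \<in> M" for z
  proof -
    have "?l = (\<Prod>c\<in>cl ` M. bexp p (?B c) (\<lambda>X.
       if c = cl z then of_bool (hit Minus X) - of_bool (hit Plus X)
       else of_bool (\<not> (hit Minus X \<and> hit Plus X))))"
      by (rule bexp_clusters[OF fin])
    also have "\<dots> = (\<Prod>c\<in>cl ` M. if c = cl z then d c else q c)"
      by (intro prod.cong refl) (auto simp: d_def q_def)
    also have "\<dots> = d (cl z) * (\<Prod>c\<in>cl ` M - {cl z}. if c = cl z then d c else q c)"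
      using fin z by (subst prod.remove[of _ "cl z"]) auto
    also have "(\<Prod>c\<in>cl ` M - {cl z}. if c = cl z then d c else q c) = (\<Prod>c\<in>cl ` M - {cl z}. q c)"
      by (intro prod.cong) auto
    finally show ?thesis .
  qed
  then have "bexp p M (\<lambda>X. \<Sum>z\<in>M. layer_sign (snd z) * (\<Prod>c\<in>cl ` M.
     if c = cl z then of_bool (hit Minus {y\<in>X. cl y = c}) - of_bool (hit Plus {y\<in>X. cl y = c})
       else of_bool (\<not> (hit Minus {y\<in>X. cl y = c} \<and> hit Plus {y\<in>X. cl y = c})))) =
     (\<Sum>z\<in>M. layer_sign (snd z) * (d (cl z) * (\<Prod>c\<in>cl ` M - {cl z}. q c)))"
    unfolding bexp_sum bexp_cmult by (intro sum.cong refl) simp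
  also have "\<dots> = (\<Sum>c\<in>cl ` M. \<Sum>z\<in>?B c. layer_sign (snd z) * (d (cl z) * (\<Prod>c\<in>cl ` M - {cl z}. q c)))"
    by (rule sum.image_gen[OF fin])
  also have "\<dots> = (\<Sum>c\<in>cl ` M. ((\<Sum>z\<in>?B c. layer_sign (snd z)) * d c) * (\<Prod>c'\<in>cl ` M - {c}. q c'))"
    by (intro sum.cong refl) (simp add: sum_distrib_right mult.assoc)
  also have "\<dots> \<ge> 0"
  proof (intro sum_nonneg)
    fix c
    have "0 \<le> (\<Sum>z\<in>?B c. layer_sign (snd z)) * d c"
      unfolding d_def using p fin by (intro cluster_sign_product_nonneg) auto
    moreover have "0 \<le> (\<Prod>c'\<in>cl ` M - {c}. q c')" using q by (simp add: prod_nonneg)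
    ultimately show "0 \<le> ((\<Sum>z\<in>?B c. layer_sign (snd z)) * d c) * (\<Prod>c'\<in>cl ` M - {c}. q c')"
      by (rule mult_nonneg_nonneg)
  qed
  finally show ?thesis .
qed

text \<open>This holds for every vertex without a loop in a finite graph: no symmetry of the neighbourhood is
  needed for the sum.\<close>
lemma nbrs_sum_signed_conn_nonneg:
  assumes V: "finite V" "\<Union>E \<subseteq> V" and p: "p \<in> {0..1}" and v: "v \<in> V" and loop: "{v} \<notin> E"
  shows "0 \<le> (\<Sum>w\<in>nbrs E v. bexp p (bunkbed_edges V E) (\<lambda>S. signed_conn S v w))"
proof -
  define R where "R = {e \<in> bunkbed_edges V E. e \<inter> {v} \<times> UNIV = {}}"
  define P where "P = {{(v, Plus), (v, Minus)}}"
  define M where "M = nbrs E v \<times> (UNIV :: layer set)"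
  define F where "F = (\<lambda>S. \<Sum>w\<in>nbrs E v. signed_conn S v w)"
  have nv: "v \<notin> nbrs E v" using loop by (auto simp: nbrs_def)
  then have M: "M \<inter> {v} \<times> UNIV = {}" by (auto simp: M_def)
  from bunkbed_edges_split[of "{v}" V E] v loop
  have EE: "bunkbed_edges V E = R \<union> (P \<union> link v ` M)"
    by (simp add: R_def P_def M_def Un_ac insert_commute)
  have fin: "finite (bunkbed_edges V E)"
    using V by (rule finite_bunkbed_edges)
  have finM: "finite M"
    using finite_subset[of "nbrs E v" V] V by (auto simp: M_def nbrs_def UNIV_layer)
  have inj: "inj_on (link v) M" using M by (auto intro!: inj_on_link)
  \<comment> \<open>a neighbour \<open>u\<close> is counted through its two copies in \<open>M\<close>, with opposite signs\<close>
  have F: "F S = (\<Sum>z\<in>M. layer_sign (snd z) *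
      (of_bool (joined S (v, Minus) z) - of_bool (joined S (v, Plus) z)))" for S
    unfolding F_def M_def UNIV_layer
    by (subst sum.cartesian_product') (simp add: signed_conn_def layer_sign_def algebra_simps)
  have "(\<Sum>w\<in>nbrs E v. bexp p (bunkbed_edges V E) (\<lambda>S. signed_conn S v w)) =
    bexp p (bunkbed_edges V E) F" by (simp add: bexp_sum F_def)
  also have "\<dots> = bexp p R (\<lambda>S. bexp p (P \<union> link v ` M) (\<lambda>T. F (S \<union> T)))"
    unfolding EE using fin M finM by (intro bexp_union) (auto simp: R_def P_def link_def)
  also have "\<dots> = bexp p R (\<lambda>S. bexp p P (\<lambda>Q. bexp p (link v ` M) (\<lambda>T. F (S \<union> (Q \<union> T)))))"
    using M finM by (intro bexp_cong bexp_union) (auto simp: P_def link_def doubleton_eq_iff)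
  also have "\<dots> = bexp p R (\<lambda>S. bexp p P (\<lambda>Q. bexp p M (\<lambda>X. F (S \<union> (Q \<union> link v ` X)))))"
    by (simp add: bexp_image inj)
  also have "\<dots> \<ge> 0"
  proof (rule bexp_nonneg[OF p], rule bexp_nonneg[OF p])
    fix S Q assume S: "S \<subseteq> R" and Q: "Q \<subseteq> P"
    show "0 \<le> bexp p M (\<lambda>X. F (S \<union> (Q \<union> link v ` X)))"
    proof (cases "Q = {}")
      case True
      have "\<And>e. e \<in> S \<Longrightarrow> e \<inter> {v} \<times> UNIV = {}" using S by (auto simp: R_def)
      note eq = star_connection_diff[OF this finM M]
      show ?thesis
        using star_sum_nonneg[OF finM p, of "\<lambda>z. (edge_rel S)\<^sup>* `` {z}"] True
        by (simp add: F eq cong: bexp_cong)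
    next
      case False
      with Q have "{(v, Minus), (v, Plus)} \<in> Q"
        by (auto simp: P_def insert_commute)
      then have "F (S \<union> (Q \<union> T)) = 0" for T
        unfolding F_def by (intro sum.neutral ballI signed_conn_zero_left joined_edge) auto
      then show ?thesis using finM by simp
    qed
  qed
  finally show ?thesis .
qed

lemma transitive_nbrs_signed_conn_nonneg:
  assumes V: "finite V" "\<Union>E \<subseteq> V" and p: "p \<in> {0..1}" and v: "v \<in> V" and loop: "{v} \<notin> E"
    and w: "w \<in> nbrs E v"
    and aut: "\<And>u. u \<in> nbrs E v \<Longrightarrow> \<exists>g. bij g \<and> image g ` E = E \<and> g ` V = V \<and> g v = v \<and> g u = w"
  shows "0 \<le> bexp p (bunkbed_edges V E) (\<lambda>S. signed_conn S v w)"
proof -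
  let ?b = "\<lambda>w. bexp p (bunkbed_edges V E) (\<lambda>S. signed_conn S v w)"
  have "?b u = ?b w" if "u \<in> nbrs E v" for u
    using aut[OF that] bexp_signed_conn_auto by metis
  then have "(\<Sum>u\<in>nbrs E v. ?b u) = card (nbrs E v) * ?b w" by simp
  with nbrs_sum_signed_conn_nonneg[OF V p v loop] have "0 \<le> card (nbrs E v) * ?b w" by simp
  moreover have "finite (nbrs E v)"
    using finite_subset[of "nbrs E v" V] V by (auto simp: nbrs_def)
  then have "0 < card (nbrs E v)" using w by (auto simp: card_gt_0_iff)
  ultimately show ?thesis by (simp add: zero_le_mult_iff)
qed

section \<open>Symmetric complete multipartite graphs\<close>

lemma image_edges_involution:
  assumes "\<And>x. g (g x) = x" "\<And>e. e \<in> E \<Longrightarrow> g ` e \<in> E"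
  shows "image g ` E = E"
proof
  show "image g ` E \<subseteq> E" using assms(2) by blast
  show "E \<subseteq> image g ` E"
  proof
    fix e assume "e \<in> E"
    moreover have "e = g ` g ` e" by (simp add: image_image assms(1))
    ultimately show "e \<in> image g ` E" using assms(2) by blast
  qed
qed

text \<open>The involution is used both for two distinct classes and for two vertices of one class.\<close>
lemma exchange_involution:
  assumes fin: "finite A" "finite B" "card A = card B" and uw: "u \<in> A" "w \<in> B"
    and "A = B \<or> A \<inter> B = {}"
  obtains g where "\<And>x. g (g x) = x" "g u = w"
    "\<And>x. x \<in> A \<Longrightarrow> g x \<in> B" "\<And>x. x \<in> B \<Longrightarrow> g x \<in> A" "\<And>x. x \<notin> A \<union> B \<Longrightarrow> g x = x"
proof (cases "A = B")
  case True
  show thesis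
    by (rule that[of "Transposition.transpose u w"])
      (use uw True in \<open>auto simp: Transposition.transpose_def\<close>)
next
  case False
  with assms(6) have ex: "x \<in> A \<Longrightarrow> x \<notin> B" "x \<in> B \<Longrightarrow> x \<notin> A" for x by blast+
  obtain f0 where f0: "bij_betw f0 A B"
    using finite_same_card_bij[OF fin] by blast
  \<comment> \<open>correct an arbitrary bijection at one point so that it sends \<open>u\<close> to \<open>w\<close>\<close>
  define f where "f = Transposition.transpose (f0 u) w \<circ> f0"
  have "f0 u \<in> B" using f0 uw by (auto simp: bij_betw_def)
  then have "bij_betw (Transposition.transpose (f0 u) w) B B"
    using uw by (intro bij_betw_transpose_iff) auto
  then have f: "bij_betw f A B" "f u = w"
    using f0 unfolding f_def by (auto intro: bij_betw_trans)
  define h where "h = inv_into A f"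
  have fh: "x \<in> A \<Longrightarrow> f x \<in> B" "x \<in> A \<Longrightarrow> h (f x) = x"
    "y \<in> B \<Longrightarrow> h y \<in> A" "y \<in> B \<Longrightarrow> f (h y) = y" for x y
    using f(1) unfolding h_def
    by (auto simp: bij_betw_def f_inv_into_f inv_into_into)
  define g where "g = (\<lambda>x. if x \<in> A then f x else if x \<in> B then h x else x)"
  have gA: "g x = f x" if "x \<in> A" for x using that by (simp add: g_def)
  have gB: "g x = h x" if "x \<in> B" for x using that ex by (simp add: g_def)
  have g0: "g x = x" if "x \<notin> A \<union> B" for x using that by (simp add: g_def)
  have gg: "g (g x) = x" for x
  proof -
    consider "x \<in> A" | "x \<in> B" | "x \<notin> A \<union> B" by blast
    then show ?thesis by cases (simp_all add: gA gB g0 fh)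
  qed
  show thesis
    by (rule that[of g]) (use gg g0 gA gB fh f(2) uw in auto)
qed

theorem corollary3:
  fixes k :: nat and V :: "'a set" and E :: "'a set set"
  assumes "k \<ge> 1"
    and "finite V"
    and "symmetric_complete_partite k V E"
  shows "bunkbed_property V E"
proof -
  obtain W :: "nat \<Rightarrow> 'a set" where
    V: "V = (\<Union>i\<in>{1..k}. W i)" and disj: "disjoint_family_on W {1..k}" and
    card: "\<And>i j. i \<in> {1..k} \<Longrightarrow> j \<in> {1..k} \<Longrightarrow> card (W i) = card (W j)" and
    E: "E = {{u, v} | u v. \<exists>i\<in>{1..k}. \<exists>j\<in>{1..k}. i \<noteq> j \<and> u \<in> W i \<and> v \<in> W j}"
    using assms(3) unfolding symmetric_complete_partite_def by blast
  have cls: "i = j" if "x \<in> W i" "x \<in> W j" "i \<in> {1..k}" "j \<in> {1..k}" for x i j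
    using that disj unfolding disjoint_family_on_def by blast
  have nbr: "{v, x} \<in> E \<longleftrightarrow> (\<exists>j\<in>{1..k}. j \<noteq> i \<and> x \<in> W j)" if "v \<in> W i" "i \<in> {1..k}" for v x i
  proof
    assume "{v, x} \<in> E"
    then obtain a b a' b' where "{v, x} = {a, b}" "a' \<in> {1..k}" "b' \<in> {1..k}" "a' \<noteq> b'" "a \<in> W a'" "b \<in> W b'"
      unfolding E by blast
    then show "\<exists>j\<in>{1..k}. j \<noteq> i \<and> x \<in> W j"
      using that cls by (metis doubleton_eq_iff)
  next
    assume "\<exists>j\<in>{1..k}. j \<noteq> i \<and> x \<in> W j"
    with that show "{v, x} \<in> E" unfolding E by blast
  qed
  have EV: "\<Union>E \<subseteq> V" unfolding E V by blast
  have loop: "{v} \<notin> E" if "v \<in> W i" "i \<in> {1..k}" for v i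
    using nbr[OF that, of v] cls that by auto
  show ?thesis
    unfolding bunkbed_property_def
  proof (intro ballI)
    fix p :: real and v w assume p: "p \<in> {0..1}" and v: "v \<in> V" and w: "w \<in> V"
    obtain i j where i: "i \<in> {1..k}" "v \<in> W i" and j: "j \<in> {1..k}" "w \<in> W j"
      using v w unfolding V by blast
    have "0 \<le> bexp p (bunkbed_edges V E) (\<lambda>S. signed_conn S v w)"
    proof (cases "v = w")
      case True
      then have "0 \<le> signed_conn S v w" for S by (simp add: signed_conn_def)
      then show ?thesis using p by (intro bexp_nonneg)
    next
      case False
      show ?thesis
      proof (cases "i = j")
        case True
        have "nbrs E v = nbrs E w"
          unfolding nbrs_def nbr[OF i(2,1)] nbr[OF j(2,1)] True ..
        then show ?thesis
          using assms(2) EV p v w False loop i j by (intro twins_signed_conn_nonneg) auto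
      next
        case ij: False
        show ?thesis
        proof (rule transitive_nbrs_signed_conn_nonneg[OF assms(2) EV p v loop[OF i(2,1)]])
          show "w \<in> nbrs E v" using nbr[OF i(2,1), of w] ij j by (auto simp: nbrs_def)
          fix u assume "u \<in> nbrs E v"
          then obtain a where a: "a \<in> {1..k}" "a \<noteq> i" "u \<in> W a"
            using nbr[OF i(2,1), of u] by (auto simp: nbrs_def)
          have fin: "finite (W c)" if "c \<in> {1..k}" for c
            using that assms(2) finite_subset[of "W c" V] unfolding V by blast
          \<comment> \<open>an automorphism that fixes \<open>v\<close> and maps \<open>u\<close> to \<open>w\<close>\<close>
          have "W a = W j \<or> W a \<inter> W j = {}" using cls a j by blast
          from exchange_involution[OF fin[OF a(1)] fin[OF j(1)] card[OF a(1) j(1)] a(3) j(2) this]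
          obtain g where g: "\<And>x. g (g x) = x" "g u = w" "\<And>x. x \<in> W a \<Longrightarrow> g x \<in> W j"
            "\<And>x. x \<in> W j \<Longrightarrow> g x \<in> W a" "\<And>x. x \<notin> W a \<union> W j \<Longrightarrow> g x = x" by blast
          have "v \<notin> W a \<union> W j" using i a j ij cls by blast
          then have gv: "g v = v" by (rule g(5))
          \<comment> \<open>\<open>g\<close> permutes the classes by exchanging \<open>W a\<close> and \<open>W j\<close>\<close>
          have gW: "g x \<in> W (Transposition.transpose a j c)" if "c \<in> {1..k}" "x \<in> W c" for c x
          proof -
            consider "c = a" | "c = j" | "c \<noteq> a" "c \<noteq> j" by blast
            then show ?thesis
            proof cases
              case 3
              then have "x \<notin> W a \<union> W j" using cls that a j by blast
              with 3 that g(5) show ?thesis by simp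
            qed (use that g(3,4) in auto)
          qed
          have tr: "Transposition.transpose a j c \<in> {1..k}" if "c \<in> {1..k}" for c
            using that a j by (auto simp: Transposition.transpose_def)
          have "bij g" using g(1) by (intro o_bij[of g g]) auto
          moreover have "image g ` E = E"
          proof (rule image_edges_involution[OF g(1)])
            fix e assume "e \<in> E"
            then obtain x y b c where xy: "e = {x, y}" "b \<in> {1..k}" "c \<in> {1..k}" "b \<noteq> c" "x \<in> W b" "y \<in> W c"
              unfolding E by blast
            then have "g x \<in> W (Transposition.transpose a j b)" "g y \<in> W (Transposition.transpose a j c)" using gW by auto
            moreover have "Transposition.transpose a j b \<noteq> Transposition.transpose a j c" using xy(4) by (metis transpose_involutory)
            moreover have "g ` e = {g x, g y}" using xy by simp
            ultimately show "g ` e \<in> E" unfolding E using tr xy(2,3) by blast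
          qed
          moreover have "g ` V = V"
          proof -
            have sub: "g x \<in> V" if "x \<in> V" for x using that gW tr unfolding V by blast
            moreover have "x \<in> g ` V" if "x \<in> V" for x
              using sub[OF that] g(1)[of x] by (metis imageI)
            ultimately show ?thesis by blast
          qed
          ultimately show "\<exists>g. bij g \<and> image g ` E = E \<and> g ` V = V \<and> g v = v \<and> g u = w"
            using g(2) gv by blast
        qed
      qed
    qed
    then show "conn_prob V E p (v, Minus) (w, Minus) \<ge> conn_prob V E p (v, Minus) (w, Plus)"
      using conn_prob_le_iff[OF assms(2) EV p v] by blast
  qed
qed

end
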